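(* Let $X$ and $Y$ be two random variables with finite means, with distribution functions $F$ and $G$ and density functions $f$ and $g$, respectively. Let $p_0\in(0,1)$. Then $$X\leq_{p_0\text{-tvar}}Y \quad\text{implies}\quad \lim_{x\to+\infty}\frac{f(x)}{g(x)}\leq 1.$$
   Context: For a random variable $X$ with distribution function $F$, the quantile function is $F^{-1}(p)=\inf\{x: F(x)\geq p\}$ for $p\in(0,1)$, and the tail value at risk is $\mathrm{TVaR}_p(X)=\frac{1}{1-p}\int_p^1 F^{-1}(u)\,du$ for $p\in[0,1)$. For $p_0\in[0,1)$, $X\leq_{p_0\text{-tvar}}Y$ means that $\mathrm{TVaR}_p(X)\leq\mathrm{TVaR}_p(Y)$ for all $p\in(p_0,1)$.
   Formalization: The limit of f(x)/g(x) as x→+∞ is assumed to exist (possibly as +∞), since it need not exist under the stated hypotheses, e.g. f(x)=Ce^{-x}(2+sin x) for x>0 and Y=X+1; the claim proved is that this limit is then at most 1. *)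

theory Defs
  imports "HOL-Probability.Probability"
begin

definition distribution_function :: "'a measure \<Rightarrow> ('a \<Rightarrow> real) \<Rightarrow> real \<Rightarrow> real" where
  "distribution_function M X = cdf (distr M borel X)"

text \<open>Meaningful for \<open>0 < p < 1\<close>, where the set is nonempty and bounded below.\<close>

definition quantile :: "'a measure \<Rightarrow> ('a \<Rightarrow> real) \<Rightarrow> real \<Rightarrow> real" where
  "quantile M X p = Inf {x. distribution_function M X x \<ge> p}"

text \<open>The integration range is the open interval because the quantile function is only
  specified on \<open>{0<..<1}\<close>. For \<open>0 \<le> p < 1\<close> the integral converges whenever \<open>X\<close> has a
  finite mean.\<close>

definition TVaR :: "'a measure \<Rightarrow> ('a \<Rightarrow> real) \<Rightarrow> real \<Rightarrow> real" where
  "TVaR M X p = 1 / (1 - p) * (LINT u:{p<..<1}|lborel. quantile M X u)"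

text \<open>The order depends only on the two laws, so the random variables may live on different
  probability spaces.\<close>

definition tvar_le ::
    "real \<Rightarrow> 'a measure \<Rightarrow> ('a \<Rightarrow> real) \<Rightarrow> 'b measure \<Rightarrow> ('b \<Rightarrow> real) \<Rightarrow> bool" where
  "tvar_le p0 M X N Y \<longleftrightarrow> (\<forall>p\<in>{p0<..<1}. TVaR M X p \<le> TVaR N Y p)"

text \<open>A real-valued (everywhere nonnegative) version of the density of \<open>X\<close> with respect to
  Lebesgue measure.\<close>

definition has_density_function :: "'a measure \<Rightarrow> ('a \<Rightarrow> real) \<Rightarrow> (real \<Rightarrow> real) \<Rightarrow> bool" where
  "has_density_function M X f \<longleftrightarrow>
     (\<forall>x. 0 \<le> f x) \<and> distributed M lborel X (\<lambda>x. ennreal (f x))"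

end

theory Submission
  imports Defs
begin

text \<open>
  Suppose \<open>L > 1\<close> and pick a real \<open>c\<close> with \<open>1 < c < L\<close>. Beyond some point \<open>a\<close> the ratio of
  the densities exceeds \<open>c\<close>, hence \<open>f > 0\<close> and \<open>f \<ge> c g\<close> there. Integrating over
  \<open>(x, \<infinity>)\<close> turns this into a comparison of the tails, \<open>c (1 - G x) \<le> 1 - F x\<close> for
  \<open>x \<ge> a\<close>, while positivity of \<open>f\<close> gives \<open>F a < 1\<close>.

  A tail that is heavier by a factor \<open>c > 1\<close> pushes all high quantiles strictly to the right:
  for \<open>F a < u < 1\<close> the point \<open>x = F\<^sup>-\<^sup>1 u\<close> lies beyond \<open>a\<close>, and \<open>c (1 - G x) \<le> 1 - u\<close>
  forces \<open>G x > u\<close>, so by continuity of \<open>G\<close> the level \<open>u\<close> is already reached to the left of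
  \<open>x\<close> (lemma \<open>quantile_less_of_tail_dominated\<close>). Averaging the strict inequality over
  \<open>(p, 1)\<close> gives a strict inequality between the values of \<open>TVaR\<close> for every \<open>p\<close> close to 1,
  against the assumed order. The averaging needs the quantile functions to be integrable;
  this is where the finite means enter, through the fact that a quantile function evaluated at
  a uniform variable reproduces the law (lemma \<open>set_integrable_quantile\<close>).
\<close>

lemma (in prob_space) cdf_distribution_distr:
  assumes "X \<in> borel_measurable M"
  shows "cdf_distribution (distr M borel X)"
  using assms by (simp add: cdf_distribution_def)

text \<open>The Galois connection between a distribution function and its quantile function.\<close>

lemma (in prob_space) le_distribution_function_iff_quantile_le:
  assumes "X \<in> borel_measurable M" "0 < p" "p < 1"
  shows "p \<le> distribution_function M X x \<longleftrightarrow> quantile M X p \<le> x"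
proof -
  interpret D: cdf_distribution "distr M borel X"
    using assms(1) by (rule cdf_distribution_distr)
  show ?thesis
    unfolding quantile_def distribution_function_def using assms(2,3) by (rule D.pseudoinverse)
qed

text \<open>On the unit interval with Lebesgue measure the quantile function is a random variable with
  the same law as \<open>X\<close>, so it inherits the integrability of \<open>X\<close>.\<close>

lemma (in prob_space) set_integrable_quantile:
  assumes X: "integrable M X" and A: "A \<in> sets borel" "A \<subseteq> {0<..<1}"
  shows "set_integrable lborel A (quantile M X)"
proof -
  have [measurable]: "X \<in> borel_measurable M"
    using X by simp
  interpret D: cdf_distribution "distr M borel X"
    by (rule cdf_distribution_distr) simp
  let ?U = "restrict_space lborel {0<..<1::real}"
  have Q: "quantile M X = D.I"
    by (simp add: fun_eq_iff quantile_def distribution_function_def)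
  have "sets ?U = sets (restrict_space borel {0<..<1::real})"
    by (rule sets_restrict_space_cong) simp
  then have m: "D.I \<in> borel_measurable ?U"
    using D.measurable_CI measurable_cong_sets by blast
  have "integrable (distr M borel X) (\<lambda>x. x)"
    using X by (simp add: integrable_distr_eq)
  then have "integrable (distr ?U borel D.I) (\<lambda>x. x)"
    by (simp add: D.distr_I_eq_M)
  then have "integrable ?U D.I"
    using m by (simp add: integrable_distr_eq)
  then have "set_integrable lborel {0<..<1} (quantile M X)"
    by (simp add: integrable_restrict_space set_integrable_def Q)
  then show ?thesis
    using A by (auto intro: set_integrable_subset)
qed

lemma set_integral_strict_mono:
  fixes h k :: "'c \<Rightarrow> real"
  assumes "set_integrable M A h" "set_integrable M A k"
    and "A \<in> sets M" "emeasure M A \<noteq> 0" "emeasure M A \<noteq> \<infinity>"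
    and less: "\<And>x. x \<in> A \<Longrightarrow> h x < k x"
  shows "(LINT x:A|M. h x) < (LINT x:A|M. k x)"
proof -
  have AM: "A \<inter> space M = A"
    using sets.sets_into_space[OF assms(3)] by auto
  interpret finite_measure "restrict_space M A"
    using assms(3,5) AM
    by (intro finite_measureI) (simp add: emeasure_restrict_space space_restrict_space)
  have "integral\<^sup>L (restrict_space M A) h < integral\<^sup>L (restrict_space M A) k"
    using assms AM
    by (intro integral_less_AE_space)
      (auto simp: integrable_restrict_space set_integrable_def emeasure_restrict_space
        space_restrict_space)
  then show ?thesis
    using assms(3) AM by (simp add: integral_restrict_space set_lebesgue_integral_def)
qed

lemma TVaR_strict_mono:
  assumes "prob_space M" "prob_space N" "integrable M X" "integrable N Y"
    and "0 \<le> p" "p < 1"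
    and "\<And>u. p < u \<Longrightarrow> u < 1 \<Longrightarrow> quantile N Y u < quantile M X u"
  shows "TVaR N Y p < TVaR M X p"
proof -
  have "(LINT u:{p<..<1}|lborel. quantile N Y u) < (LINT u:{p<..<1}|lborel. quantile M X u)"
    using assms
    by (intro set_integral_strict_mono prob_space.set_integrable_quantile) auto
  then show ?thesis
    using assms(6) unfolding TVaR_def by (intro mult_strict_left_mono) auto
qed

lemma one_minus_distribution_function_eq_density_integral:
  assumes "prob_space M" "has_density_function M X f"
  shows "ennreal (1 - distribution_function M X x) = (\<integral>\<^sup>+t. ennreal (f t) * indicator {x<..} t \<partial>lborel)"
proof -
  interpret prob_space M by fact
  have d: "distributed M lborel X (\<lambda>t. ennreal (f t))"
    using assms(2) by (simp add: has_density_function_def)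
  then have [measurable]: "X \<in> borel_measurable M"
    by (auto dest: distributed_measurable)
  interpret D: cdf_distribution "distr M borel X"
    by (rule cdf_distribution_distr) simp
  have "measure (distr M borel X) {x<..} = 1 - distribution_function M X x"
    using D.prob_compl[of "{..x}"]
    by (simp add: distribution_function_def cdf_def Compl_eq_Diff_UNIV[symmetric])
  then have "ennreal (1 - distribution_function M X x) = emeasure (distr M borel X) {x<..}"
    by (simp add: D.emeasure_eq_measure)
  also have "\<dots> = emeasure M (X -` {x<..} \<inter> space M)"
    by (simp add: emeasure_distr)
  also have "\<dots> = (\<integral>\<^sup>+t. ennreal (f t) * indicator {x<..} t \<partial>lborel)"
    using d by (rule distributed_emeasure) simp
  finally show ?thesis .
qed

lemma isCont_distribution_function:
  assumes "prob_space M" "has_density_function M X f"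
  shows "isCont (distribution_function M X) x"
proof -
  interpret prob_space M by fact
  have d: "distributed M lborel X (\<lambda>t. ennreal (f t))"
    using assms(2) by (simp add: has_density_function_def)
  then have [measurable]: "X \<in> borel_measurable M"
    by (auto dest: distributed_measurable)
  interpret D: cdf_distribution "distr M borel X"
    by (rule cdf_distribution_distr) simp
  have "emeasure (distr M borel X) {x} = emeasure M (X -` {x} \<inter> space M)"
    by (simp add: emeasure_distr)
  also have "\<dots> = (\<integral>\<^sup>+t. ennreal (f t) * indicator {x} t \<partial>lborel)"
    using d by (rule distributed_emeasure) simp
  also have "\<dots> = 0"
    by simp
  finally show ?thesis
    by (simp add: distribution_function_def D.isCont_cdf measure_def)
qed

lemma distribution_function_less_1:
  assumes "prob_space M" "has_density_function M X f"
    and pos: "\<And>t. a < t \<Longrightarrow> 0 < f t"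
  shows "distribution_function M X a < 1"
proof (rule ccontr)
  assume "\<not> ?thesis"
  then have "(\<integral>\<^sup>+t. ennreal (f t) * indicator {a<..} t \<partial>lborel) = 0"
    using one_minus_distribution_function_eq_density_integral[OF assms(1,2), of a]
    by (simp add: ennreal_neg)
  moreover have [measurable]: "(\<lambda>t. ennreal (f t)) \<in> borel_measurable lborel"
    using assms(2) by (simp add: has_density_function_def distributed_def)
  ultimately have "AE t in lborel. ennreal (f t) * indicator {a<..} t = 0"
    by (subst (asm) nn_integral_0_iff_AE) auto
  then have "AE t in lborel. t \<notin> {a<..}"
    using pos by (auto elim!: eventually_mono simp: indicator_def ennreal_eq_0_iff split: if_splits)
      (meson not_le)
  then have "emeasure lborel {a<..} = 0"
    by (subst (asm) AE_iff_measurable[OF _ refl]) (auto simp: greaterThan_def)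
  (* a bounded interval has an explicit, positive length *)
  then have "emeasure lborel {a<..<a + 1} = 0"
    using emeasure_mono[of "{a<..<a + 1}" "{a<..}" lborel]
    by (simp add: greaterThanLessThan_def)
  then show False by simp
qed

lemma tail_dominated_of_density_dominated:
  assumes "prob_space M" "prob_space N"
    and f: "has_density_function M X f" and g: "has_density_function N Y g"
    and "0 \<le> c" and le: "\<And>t. x < t \<Longrightarrow> c * g t \<le> f t"
  shows "c * (1 - distribution_function N Y x) \<le> 1 - distribution_function M X x"
proof -
  have [measurable]: "(\<lambda>t. ennreal (g t)) \<in> borel_measurable lborel"
    using g by (simp add: has_density_function_def distributed_def)
  have X: "X \<in> borel_measurable M"
    using f by (auto simp: has_density_function_def dest: distributed_measurable)
  interpret D: cdf_distribution "distr M borel X"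
    using assms(1) X by (rule prob_space.cdf_distribution_distr)
  have "ennreal (c * (1 - distribution_function N Y x))
      = ennreal c * (\<integral>\<^sup>+t. ennreal (g t) * indicator {x<..} t \<partial>lborel)"
    using \<open>0 \<le> c\<close>
    by (simp add: ennreal_mult' one_minus_distribution_function_eq_density_integral[OF assms(2) g])
  also have "\<dots> = (\<integral>\<^sup>+t. ennreal (c * g t) * indicator {x<..} t \<partial>lborel)"
    using \<open>0 \<le> c\<close> by (simp add: nn_integral_cmult[symmetric] ennreal_mult' mult.assoc)
  also have "\<dots> \<le> (\<integral>\<^sup>+t. ennreal (f t) * indicator {x<..} t \<partial>lborel)"
    using le by (intro nn_integral_mono) (auto simp: indicator_def intro: ennreal_leI)
  also have "\<dots> = ennreal (1 - distribution_function M X x)"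
    by (simp add: one_minus_distribution_function_eq_density_integral[OF assms(1) f])
  finally show ?thesis
    using D.cdf_bounded_prob[of x]
    by (subst (asm) ennreal_le_iff) (auto simp: distribution_function_def)
qed

text \<open>Strictness comes from the factor \<open>c > 1\<close>: at \<open>x = F\<^sup>-\<^sup>1 u\<close> the distribution function of
  \<open>Y\<close> exceeds \<open>u\<close>, and continuity leaves room to move to the left of \<open>x\<close>.\<close>

lemma quantile_less_of_tail_dominated:
  assumes "prob_space M" "prob_space N"
    and X: "X \<in> borel_measurable M" and Y: "Y \<in> borel_measurable N"
    and cont: "\<And>x. isCont (distribution_function N Y) x"
    and "1 < c"
    and tail: "\<And>x. a \<le> x \<Longrightarrow>
      c * (1 - distribution_function N Y x) \<le> 1 - distribution_function M X x"
    and u: "0 < u" "u < 1" "distribution_function M X a < u"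
  shows "quantile N Y u < quantile M X u"
proof -
  let ?F = "distribution_function M X" and ?G = "distribution_function N Y"
  define x where "x = quantile M X u"
  note F_iff = prob_space.le_distribution_function_iff_quantile_le[OF assms(1) X u(1,2)]
  note G_iff = prob_space.le_distribution_function_iff_quantile_le[OF assms(2) Y u(1,2)]
  have "u \<le> ?F x"
    using F_iff[of x] by (simp add: x_def)
  have "a < x"
    using F_iff[of a] u(3) by (simp add: x_def)
  have "u < ?G x"
  proof (rule ccontr)
    assume "\<not> u < ?G x"
    then have "1 - u \<le> 1 - ?G x" by simp
    also have "\<dots> < c * (1 - ?G x)"
      using \<open>1 < c\<close> \<open>\<not> u < ?G x\<close> u(2) by simp
    also have "\<dots> \<le> 1 - u"
      using tail[of x] \<open>a < x\<close> \<open>u \<le> ?F x\<close> by simp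
    finally show False by simp
  qed
  moreover have "(?G \<longlongrightarrow> ?G x) (at_left x)"
    using cont[of x] by (simp add: isCont_def filterlim_at_split)
  ultimately have "\<forall>\<^sub>F y in at_left x. u < ?G y"
    by (simp add: order_tendstoD(1))
  moreover have "\<forall>\<^sub>F y in at_left x. y < x"
    by (simp add: eventually_at_filter)
  ultimately have "\<forall>\<^sub>F y in at_left x. u < ?G y \<and> y < x"
    by (rule eventually_conj)
  then obtain y where "u < ?G y" "y < x"
    using eventually_happens'[OF trivial_limit_at_left_real] by blast
  then show ?thesis
    using G_iff[of y] by (simp add: x_def)
qed

text \<open>In the extended reals \<open>0 / 0 = 0\<close>, so a quotient above a nonnegative bound forces a positive
  numerator even where the denominator vanishes.\<close>

lemma ereal_divide_gt_imp:
  fixes r s c :: real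
  assumes "0 \<le> r" "0 \<le> s" "0 \<le> c" "ereal c < ereal r / ereal s"
  shows "0 < r" and "c * s \<le> r"
proof -
  have r: "r \<noteq> 0"
  proof
    assume "r = 0"
    then have "ereal r / ereal s = 0"
      unfolding divide_ereal_def zero_ereal_def[symmetric] by simp
    then show False using assms(3,4) by simp
  qed
  then show "0 < r" using assms by simp
  show "c * s \<le> r"
  proof (cases "s = 0")
    case False
    then have "c < r / s" using assms(4) by simp
    then show ?thesis using False assms(2) by (simp add: field_simps)
  qed (use assms in simp)
qed

theorem proposition2p13:
  fixes M :: "'a measure" and N :: "'b measure"
    and X :: "'a \<Rightarrow> real" and Y :: "'b \<Rightarrow> real"
    and f g :: "real \<Rightarrow> real" and p0 :: real and L :: ereal
  assumes "prob_space M" and "prob_space N"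
    and "integrable M X" and "integrable N Y"
    and "has_density_function M X f" and "has_density_function N Y g"
    and "0 < p0" and "p0 < 1"
    and "tvar_le p0 M X N Y"
    and "((\<lambda>x. ereal (f x) / ereal (g x)) \<longlongrightarrow> L) at_top"
  shows "L \<le> 1"
proof (rule ccontr)
  assume "\<not> L \<le> 1"
  then obtain c where c: "1 < c" "ereal c < L"
    using ereal_dense2[of 1 L] by (auto simp: not_le)
  have nonneg: "0 \<le> f t" "0 \<le> g t" for t
    using assms(5,6) by (auto simp: has_density_function_def)
  have "\<forall>\<^sub>F t in at_top. ereal c < ereal (f t) / ereal (g t)"
    using assms(10) c(2) by (rule order_tendstoD(1))
  then obtain a where a: "ereal c < ereal (f t) / ereal (g t)" if "a \<le> t" for t
    by (auto simp: eventually_at_top_linorder)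
  have pos: "0 < f t" and le: "c * g t \<le> f t" if "a \<le> t" for t
    using ereal_divide_gt_imp[OF nonneg _ a[OF that]] c(1) by auto
  have Fa: "distribution_function M X a < 1"
    using assms(1,5) pos by (rule distribution_function_less_1) simp
  have tail: "c * (1 - distribution_function N Y x) \<le> 1 - distribution_function M X x"
    if "a \<le> x" for x
    using assms(1,2,5,6) c(1) le that by (intro tail_dominated_of_density_dominated) auto
  obtain p where p: "max p0 (distribution_function M X a) < p" "p < 1"
    using Fa assms(8) dense[of "max p0 (distribution_function M X a)" 1] by auto
  have "quantile N Y u < quantile M X u" if "p < u" "u < 1" for u
    using assms(1-4) isCont_distribution_function[OF assms(2,6)] c(1) tail that p assms(7)
    by (intro quantile_less_of_tail_dominated[where a = a and c = c]) auto
  then have "TVaR N Y p < TVaR M X p"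
    using assms(1-4,7) p by (intro TVaR_strict_mono) auto
  then show False
    using assms(9) p by (auto simp: tvar_le_def not_le[symmetric])
qed

end
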